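(* For every composition $\beta$, \[ H_\beta = \sum_T (1-q)^{n(T)}\,\mathcal{Q}'_{\mathrm{shape}(T)}, \] the sum over all immaculate tableaux $T$ of content $\beta$.
   Context: Work over $\mathbb{Q}(q)$. $\mathrm{NSym}$ is the free associative algebra on $H_1,H_2,\dots$ ($H_\beta=H_{\beta_1}\cdots H_{\beta_k}$, $H_0=1$, $H_{-r}=0$ for $r>0$), graded dual to $\mathrm{QSym}$ via $\langle H_\alpha,M_\beta\rangle=\delta_{\alpha\beta}$ ($M_\beta$ monomial quasisymmetric functions), coproduct $\Delta(H_j)=\sum_iH_i\otimes H_{j-i}$. For $F\in\mathrm{QSym}$, $F^\perp$ satisfies $\langle F^\perp(H),G\rangle=\langle H,FG\rangle$. $F_i=\sum_{\gamma\models i}M_\gamma$ ($F_0=1$), $F_{1^i}=M_{1^i}$. Let $\mathbb{B}_m=\sum_{i\ge0}(-1)^iH_{m+i}F_{1^i}^\perp$, $\widetilde{\mathbb{B}}_m(f)=\sum_{i\ge0}q^i\mathbb{B}_{m+i}(F_i^\perp(f))$, and $\mathcal{Q}'_\alpha=\widetilde{\mathbb{B}}_{\alpha_1}\cdots\widetilde{\mathbb{B}}_{\alpha_m}(1)$. An immaculate tableau of shape $\alpha$ and content $\beta$ (compositions) is a filling of the diagram of $\alpha$ (left-justified rows of lengths $\alpha_i$, row 1 on top) with positive integers, $\beta_i$ of them equal to $i$, rows weakly increasing, first column strictly increasing top to bottom. For such $T$, $n(T)=\sum_{j=1}^{\ell(\alpha)}(d_j(T)-1)$ where $d_j(T)$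 is the number of distinct entries in row $j$. *)

theory Defs
  imports "HOL-Library.Poly_Mapping" "HOL-Computational_Algebra.Polynomial"
    "HOL-Computational_Algebra.Fraction_Field"
begin

section \<open>Compositions\<close>

typedef composition = "{xs :: nat list. \<forall>x\<in>set xs. 0 < x}"
  morphisms parts Composition
  by (rule exI[of _ "[]"]) simp

setup_lifting type_definition_composition

text \<open>
  Under concatenation, compositions are the free monoid on the positive integers, that is, the
  monoid of words in the letters \<open>H\<^sub>1, H\<^sub>2, \<dots>\<close>.  Addition on this type is concatenation.
\<close>

instantiation composition :: monoid_add
begin

lift_definition zero_composition :: composition is "[]"
  by simp

lift_definition plus_composition :: "composition \<Rightarrow> composition \<Rightarrow> composition" is "(@)"
  by auto

instance
  by standard (transfer; simp)+

end

lemma parts_zero [simp]: "parts 0 = []"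
  by (rule zero_composition.rep_eq)

lemma parts_plus [simp]: "parts (\<alpha> + \<beta>) = parts \<alpha> @ parts \<beta>"
  by (rule plus_composition.rep_eq)

lemma parts_pos: "x \<in> set (parts \<alpha>) \<Longrightarrow> 0 < x"
  using parts[of \<alpha>] by auto

lemma parts_Composition: "(\<And>x. x \<in> set xs \<Longrightarrow> 0 < x) \<Longrightarrow> parts (Composition xs) = xs"
  by (simp add: Composition_inverse)


section \<open>Noncommutative symmetric functions over $\mathbb{Q}(q)$\<close>

type_synonym ratfun = "rat poly fract"

definition q :: ratfun where
  "q = Fract [:0, 1:] 1"

text \<open>
  The free associative algebra on \<open>H\<^sub>1, H\<^sub>2, \<dots>\<close>: finitely supported functions on words,
  with the ring structure of the monoid algebra that \<open>Poly_Mapping\<close> provides.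
\<close>

type_synonym nsym = "composition \<Rightarrow>\<^sub>0 ratfun"

definition scale :: "ratfun \<Rightarrow> nsym \<Rightarrow> nsym" where
  "scale c f = Poly_Mapping.map ((*) c) f"

text \<open>\<open>ncH r\<close> is the generator \<open>H\<^sub>r\<close>, with \<open>H\<^sub>0 = 1\<close> and \<open>H\<^sub>r = 0\<close> for negative \<open>r\<close>.\<close>

definition ncH :: "int \<Rightarrow> nsym" where
  "ncH r = (if r < 0 then 0 else if r = 0 then 1
            else Poly_Mapping.single (Composition [nat r]) 1)"

definition ncH_comp :: "composition \<Rightarrow> nsym" where
  "ncH_comp \<beta> = prod_list (map (\<lambda>b. ncH (int b)) (parts \<beta>))"

lemma ncH_comp_eq_single: "ncH_comp \<beta> = Poly_Mapping.single \<beta> 1"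
proof -
  have "prod_list (map (\<lambda>b. ncH (int b)) xs) = Poly_Mapping.single (Composition xs) 1"
    if "\<forall>x\<in>set xs. 0 < x" for xs
    using that
  proof (induction xs)
    case Nil
    have "Composition [] = 0"
      by (simp add: zero_composition_def)
    then show ?case by simp
  next
    case (Cons a xs)
    have "Composition (a # xs) = Composition [a] + Composition xs"
    proof (rule parts_inject[THEN iffD1])
      have "parts (Composition (a # xs)) = a # xs" "parts (Composition [a]) = [a]"
        "parts (Composition xs) = xs"
        using Cons.prems by (auto intro!: parts_Composition)
      then show "parts (Composition (a # xs)) = parts (Composition [a] + Composition xs)"
        by simp
    qed
    then show ?case
      using Cons by (simp add: ncH_def mult_single)
  qed
  from this[of "parts \<beta>"] show ?thesis
    using parts_pos[of _ \<beta>] by (simp add: ncH_comp_def parts_inverse)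
qed


section \<open>Quasisymmetric functions\<close>

text \<open>
  A formal power series in countably many commuting variables \<open>x\<^sub>0, x\<^sub>1, \<dots>\<close> is the function giving
  the coefficient of every monomial; a monomial is its finitely supported exponent function.
  Series are written as plain functions; their product is \<open>mult_series\<close>.
\<close>

type_synonym monomial = "nat \<Rightarrow>\<^sub>0 nat"
type_synonym series = "monomial \<Rightarrow> ratfun"

definition mult_series :: "series \<Rightarrow> series \<Rightarrow> series" where
  "mult_series F G m = (\<Sum>(a, b) \<in> {(a, b). a + b = m}. F a * G b)"

definition mdeg :: "monomial \<Rightarrow> nat" where
  "mdeg m = (\<Sum>i\<in>Poly_Mapping.keys m. Poly_Mapping.lookup m i)"

definition xmono :: "nat list \<Rightarrow> nat list \<Rightarrow> monomial" where
  "xmono is as = sum_list (map2 Poly_Mapping.single is as)"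

definition QSym :: "series set" where
  "QSym = {G. (\<exists>d. \<forall>m. G m \<noteq> 0 \<longrightarrow> mdeg m \<le> d) \<and>
     (\<forall>\<alpha> is js. sorted_wrt (<) is \<and> sorted_wrt (<) js \<and>
        length is = length (parts \<alpha>) \<and> length js = length (parts \<alpha>) \<longrightarrow>
        G (xmono is (parts \<alpha>)) = G (xmono js (parts \<alpha>)))}"

text \<open>\<open>qsM \<beta>\<close> is the sum of the monomials \<open>x\<^bsub>i1\<^esub>\<^bsup>\<beta>1\<^esup> \<cdots> x\<^bsub>ik\<^esub>\<^bsup>\<beta>k\<^esup>\<close> over all \<open>i1 < \<dots> < ik\<close>.\<close>

definition qsM :: "composition \<Rightarrow> series" where
  "qsM \<beta> m =
     (if \<exists>is. sorted_wrt (<) is \<and> length is = length (parts \<beta>) \<and> m = xmono is (parts \<beta>)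
      then 1 else 0)"

definition qsF :: "nat \<Rightarrow> series" where
  "qsF i m = (\<Sum>\<gamma> \<in> {\<gamma>. sum_list (parts \<gamma>) = i}. qsM \<gamma> m)"

definition qsF_ones :: "nat \<Rightarrow> series" where
  "qsF_ones i = qsM (Composition (replicate i 1))"

text \<open>
  For quasisymmetric \<open>G\<close>, the coefficient of \<open>M\<^sub>\<alpha>\<close> in the expansion of \<open>G\<close> is the coefficient of
  \<open>x\<^sub>0\<^bsup>\<alpha>1\<^esup> x\<^sub>1\<^bsup>\<alpha>2\<^esup> \<cdots>\<close>; the pairing below is thus the bilinear one with
  \<open>\<langle>H\<^sub>\<alpha>, M\<^sub>\<beta>\<rangle> = \<delta>\<close> (see \<open>pairing_ncH_qsM\<close>).
\<close>

definition qs_coeff :: "series \<Rightarrow> composition \<Rightarrow> ratfun" where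
  "qs_coeff G \<alpha> = G (xmono [0..<length (parts \<alpha>)] (parts \<alpha>))"

definition pairing :: "nsym \<Rightarrow> series \<Rightarrow> ratfun" where
  "pairing H G = (\<Sum>\<alpha>\<in>Poly_Mapping.keys H. Poly_Mapping.lookup H \<alpha> * qs_coeff G \<alpha>)"

text \<open>\<open>perp F\<close> is $F^\perp$, the adjoint of multiplication by \<open>F\<close>; see \<open>ex1_perp\<close> for existence
  and uniqueness.\<close>

definition perp :: "series \<Rightarrow> nsym \<Rightarrow> nsym" where
  "perp F H = (THE K. \<forall>G\<in>QSym. pairing K G = pairing H (mult_series F G))"


section \<open>Creation operators\<close>

text \<open>
  The sums over all \<open>i \<ge> 0\<close> have only finitely many nonzero terms for each argument
  (\<open>finite_opB\<close>, \<open>finite_opBt\<close>); \<open>Sum_any\<close> adds up the nonzero terms.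
\<close>

definition opB :: "int \<Rightarrow> nsym \<Rightarrow> nsym" where
  "opB m f = Sum_any (\<lambda>i::nat. scale ((-1) ^ i) (ncH (m + int i) * perp (qsF_ones i) f))"

definition opBt :: "int \<Rightarrow> nsym \<Rightarrow> nsym" where
  "opBt m f = Sum_any (\<lambda>i::nat. scale (q ^ i) (opB (m + int i) (perp (qsF i) f)))"

definition Q' :: "composition \<Rightarrow> nsym" where
  "Q' \<alpha> = foldr (\<lambda>a. opBt (int a)) (parts \<alpha>) 1"


section \<open>Immaculate tableaux\<close>

text \<open>
  A filling of a composition diagram is the list of its rows, top to bottom, none of them empty.
\<close>

definition immaculate_tableau :: "nat list list \<Rightarrow> bool" where
  "immaculate_tableau T \<longleftrightarrow>
     (\<forall>r\<in>set T. r \<noteq> [] \<and> (\<forall>x\<in>set r. 0 < x) \<and> sorted r) \<and> sorted_wrt (<) (map hd T)"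

definition shape :: "nat list list \<Rightarrow> composition" where
  "shape T = Composition (map length T)"

definition has_content :: "nat list list \<Rightarrow> composition \<Rightarrow> bool" where
  "has_content T \<beta> \<longleftrightarrow>
     set (concat T) \<subseteq> {1..length (parts \<beta>)} \<and>
     (\<forall>i\<in>{1..length (parts \<beta>)}. count_list (concat T) i = parts \<beta> ! (i - 1))"

definition tab_stat :: "nat list list \<Rightarrow> nat" where
  "tab_stat T = (\<Sum>r\<leftarrow>T. card (set r) - 1)"


section \<open>The definitions are meaningful\<close>

lemma parts_shape: "immaculate_tableau T \<Longrightarrow> parts (shape T) = map length T"
  unfolding shape_def immaculate_tableau_def by (rule parts_Composition) auto

lemma finite_tableaux: "finite {T. immaculate_tableau T \<and> has_content T \<beta>}"
proof -
  let ?n = "length (parts \<beta>)" and ?s = "sum_list (parts \<beta>)"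
  let ?R = "{r. set r \<subseteq> {1..?n} \<and> length r \<le> ?s}"
  have fin: "finite {T. set T \<subseteq> ?R \<and> length T \<le> ?s}"
    by (intro finite_lists_length_le) simp
  show ?thesis
  proof (rule finite_subset[OF _ fin], safe)
    fix T assume T: "immaculate_tableau T" and c: "has_content T \<beta>"
    have "length (concat T) = (\<Sum>i\<in>{1..?n}. count_list (concat T) i)"
    proof -
      have sub: "set (concat T) \<subseteq> {1..?n}"
        using c by (simp add: has_content_def)
      have "(\<Sum>i\<in>{1..?n}. count_list (concat T) i) =
          (\<Sum>i\<in>set (concat T). count_list (concat T) i)"
        by (rule sum.mono_neutral_right[OF _ sub]) (auto simp: count_list_0_iff)
      then show ?thesis by (simp only: sum_count_set[OF subset_refl finite_set])
    qed
    also have "\<dots> = (\<Sum>i\<in>{1..?n}. parts \<beta> ! (i - 1))"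
      using c by (intro sum.cong) (auto simp: has_content_def)
    also have "\<dots> = (\<Sum>i<?n. parts \<beta> ! i)"
      by (rule sum.reindex_bij_witness[of _ Suc "\<lambda>i. i - 1"]) auto
    also have "\<dots> = ?s"
      by (simp add: sum_list_sum_nth atLeast0LessThan)
    finally have s: "sum_list (map length T) = ?s"
      by (simp add: length_concat)
    show "length T \<le> ?s"
    proof -
      have "(\<Sum>r\<leftarrow>T. 1) \<le> (\<Sum>r\<leftarrow>T. length r)"
        using T by (intro sum_list_mono) (auto simp: immaculate_tableau_def Suc_le_eq)
      then show ?thesis using s by (simp add: sum_list_triv)
    qed
    fix r assume r: "r \<in> set T"
    show "length r \<le> ?s"
      using member_le_sum_list[of "length r" "map length T"] r s by simp
    show "x \<in> {1..?n}" if "x \<in> set r" for x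
      using c r that by (auto simp: has_content_def)
  qed
qed

definition exps :: "monomial \<Rightarrow> nat list" where
  "exps m = map (Poly_Mapping.lookup m) (sorted_list_of_set (Poly_Mapping.keys m))"

lemma exps_pos: "x \<in> set (exps m) \<Longrightarrow> 0 < x"
  by (auto simp: exps_def in_keys_iff)

lemma xmono_exps: "xmono (sorted_list_of_set (Poly_Mapping.keys m)) (exps m) = m"
proof -
  have "xmono xs (map (Poly_Mapping.lookup m) xs) =
      (\<Sum>i\<in>set xs. Poly_Mapping.single i (Poly_Mapping.lookup m i))" if "distinct xs" for xs
    using that by (induction xs) (auto simp: xmono_def)
  moreover have "m = (\<Sum>i\<in>Poly_Mapping.keys m. Poly_Mapping.single i (Poly_Mapping.lookup m i))"
    by (rule poly_mapping_eqI)
      (auto simp: lookup_sum lookup_single when_def in_keys_iff sum.delta)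
  ultimately show ?thesis
    by (simp add: exps_def)
qed

lemma
  assumes "sorted_wrt (<) is" "length is = length as" "\<And>x. x \<in> set as \<Longrightarrow> 0 < x"
  shows keys_xmono: "Poly_Mapping.keys (xmono is as) = set is"
    and exps_xmono: "exps (xmono is as) = as"
proof -
  have *: "Poly_Mapping.keys (xmono is as) = set is \<and> map (Poly_Mapping.lookup (xmono is as)) is = as"
    using assms(2,1,3)
  proof (induction "is" as rule: list_induct2)
    case Nil
    then show ?case by (simp add: xmono_def)
  next
    case (Cons i "is" a as)
    have IH: "Poly_Mapping.keys (xmono is as) = set is"
        "map (Poly_Mapping.lookup (xmono is as)) is = as"
      using Cons by auto
    have i: "i \<notin> set is" using Cons.prems by auto
    have e: "xmono (i # is) (a # as) = Poly_Mapping.single i a + xmono is as"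
      by (simp add: xmono_def)
    have l: "Poly_Mapping.lookup (xmono is as) i = 0"
      using i IH(1) by (auto simp: in_keys_iff)
    have m: "map (Poly_Mapping.lookup (xmono (i # is) (a # as))) is = as"
    proof -
      have "map (Poly_Mapping.lookup (xmono (i # is) (a # as))) is =
          map (Poly_Mapping.lookup (xmono is as)) is"
        using i by (intro map_cong) (auto simp: e lookup_add lookup_single when_def)
      with IH(2) show ?thesis by simp
    qed
    have k: "Poly_Mapping.keys (xmono (i # is) (a # as)) = insert i (set is)"
    proof (rule set_eqI)
      fix j
      have a: "0 < a" using Cons.prems by auto
      have j: "j \<in> set is \<longleftrightarrow> Poly_Mapping.lookup (xmono is as) j \<noteq> 0"
        unfolding IH(1)[symmetric] by (rule in_keys_iff)
      show "j \<in> Poly_Mapping.keys (xmono (i # is) (a # as)) \<longleftrightarrow> j \<in> insert i (set is)"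
        unfolding in_keys_iff e lookup_add insert_iff j
        using a by (cases "j = i") (simp_all add: lookup_single_not_eq)
    qed
    have "Poly_Mapping.lookup (xmono (i # is) (a # as)) i = a"
      by (simp add: e lookup_add l)
    with m k show ?case by simp
  qed
  then show "Poly_Mapping.keys (xmono is as) = set is" by simp
  have "sorted_list_of_set (set is) = is"
    using assms(1) by (simp add: sorted_list_of_set.idem_if_sorted_distinct strict_sorted_iff)
  with * show "exps (xmono is as) = as"
    by (simp add: exps_def)
qed

lemma qsM_eq: "qsM \<beta> m = (if exps m = parts \<beta> then 1 else 0)"
proof -
  have "(\<exists>is. sorted_wrt (<) is \<and> length is = length (parts \<beta>) \<and> m = xmono is (parts \<beta>))
      \<longleftrightarrow> exps m = parts \<beta>"
  proof
    assume "exps m = parts \<beta>"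
    then show "\<exists>is. sorted_wrt (<) is \<and> length is = length (parts \<beta>) \<and> m = xmono is (parts \<beta>)"
      by (intro exI[of _ "sorted_list_of_set (Poly_Mapping.keys m)"])
        (metis exps_def length_map strict_sorted_list_of_set xmono_exps)
  qed (auto intro!: exps_xmono parts_pos)
  then show ?thesis by (simp add: qsM_def)
qed

lemma mdeg_exps: "mdeg m = sum_list (exps m)"
  by (simp add: mdeg_def exps_def sum_list_distinct_conv_sum_set)

lemma mdeg_add: "mdeg (a + b) = mdeg a + mdeg b"
proof -
  have *: "mdeg m = (\<Sum>i\<in>A. Poly_Mapping.lookup m i)"
    if "finite A" "Poly_Mapping.keys m \<subseteq> A" for m A
    unfolding mdeg_def using that
    by (intro sum.mono_neutral_left) (auto simp: in_keys_iff)
  let ?A = "Poly_Mapping.keys a \<union> Poly_Mapping.keys b"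
  show ?thesis
    using keys_add[of a b] by (simp add: *[of ?A] lookup_add sum.distrib)
qed

lemma finite_add_eq: "finite {(a, b). a + b = (m :: monomial)}"
proof -
  let ?f = "\<lambda>a :: monomial. Poly_Mapping.lookup a"
  have "finite {g. \<forall>i. (i \<in> Poly_Mapping.keys m \<longrightarrow> g i \<in> {..mdeg m}) \<and>
      (i \<notin> Poly_Mapping.keys m \<longrightarrow> g i = (0::nat))}" (is "finite ?G")
    by (rule finite_set_of_finite_funs) auto
  moreover have "?f ` {a. \<exists>b. a + b = m} \<subseteq> ?G"
  proof safe
    fix a b :: monomial and i
    assume "i \<in> Poly_Mapping.keys (a + b)"
    have "?f a i \<le> mdeg a"
      by (cases "i \<in> Poly_Mapping.keys a")
        (auto simp: mdeg_def in_keys_iff intro: member_le_sum)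
    then show "?f a i \<le> mdeg (a + b)" by (simp add: mdeg_add)
  next
    fix a b :: monomial and i
    assume "i \<notin> Poly_Mapping.keys (a + b)"
    then show "?f a i = 0" by (simp add: in_keys_iff lookup_add)
  qed
  ultimately have "finite (?f ` {a. \<exists>b. a + b = m})" by (rule finite_subset[rotated])
  then have fin: "finite {a. \<exists>b. a + b = m}"
    by (rule finite_imageD) (simp add: inj_on_def)
  have "{(a, b). a + b = m} \<subseteq> (\<lambda>a. (a, m - a)) ` {a. \<exists>b. a + b = m}"
    by force
  then show ?thesis using fin by (meson finite_imageI finite_subset)
qed

lemma qsM_QSym: "qsM \<beta> \<in> QSym"
  unfolding QSym_def
proof (intro CollectI conjI allI impI)
  show "\<exists>d. \<forall>m. qsM \<beta> m \<noteq> 0 \<longrightarrow> mdeg m \<le> d"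
    by (auto simp: qsM_eq mdeg_exps intro!: exI[of _ "sum_list (parts \<beta>)"])
qed (auto simp: qsM_eq exps_xmono parts_pos)

lemma qs_coeff_qsM: "qs_coeff (qsM \<beta>) \<alpha> = (if \<alpha> = \<beta> then 1 else 0)"
  by (auto simp: qs_coeff_def qsM_eq exps_xmono parts_pos parts_inject)

lemma QSym_coeff: "G \<in> QSym \<Longrightarrow> qs_coeff G (Composition (exps m)) = G m"
proof -
  assume G: "G \<in> QSym"
  let ?a = "Composition (exps m)" and ?is = "sorted_list_of_set (Poly_Mapping.keys m)"
  have p: "parts ?a = exps m"
    by (rule parts_Composition) (rule exps_pos)
  have "G (xmono [0..<length (parts ?a)] (parts ?a)) = G (xmono ?is (parts ?a))"
  proof -
    have "sorted_wrt (<) [0..<length (parts ?a)]" "sorted_wrt (<) ?is"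
      "length [0..<length (parts ?a)] = length (parts ?a)" "length ?is = length (parts ?a)"
      by (simp_all add: p) (simp add: exps_def)
    then show ?thesis using G unfolding QSym_def by blast
  qed
  then show ?thesis by (simp add: qs_coeff_def p xmono_exps)
qed

lemma pairing_superset:
  "finite A \<Longrightarrow> Poly_Mapping.keys H \<subseteq> A \<Longrightarrow>
    pairing H G = (\<Sum>\<alpha>\<in>A. Poly_Mapping.lookup H \<alpha> * qs_coeff G \<alpha>)"
  unfolding pairing_def by (intro sum.mono_neutral_left) (auto simp: in_keys_iff)

lemma pairing_add: "pairing (H + K) G = pairing H G + pairing K G"
  using keys_add[of H K]
  by (simp add: pairing_superset[of "Poly_Mapping.keys H \<union> Poly_Mapping.keys K"] lookup_add
      distrib_right sum.distrib)

lemma pairing_zero: "pairing 0 G = 0"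
  by (simp add: pairing_def)

lemma pairing_sum: "pairing (sum f A) G = (\<Sum>x\<in>A. pairing (f x) G)"
  by (induction A rule: infinite_finite_induct) (simp_all add: pairing_add pairing_zero)

lemma pairing_single: "pairing (Poly_Mapping.single \<alpha> c) G = c * qs_coeff G \<alpha>"
  by (simp add: pairing_superset[of "{\<alpha>}"])

lemma pairing_ncH_qsM: "pairing (ncH_comp \<alpha>) (qsM \<beta>) = (if \<alpha> = \<beta> then 1 else 0)"
  by (simp add: ncH_comp_eq_single pairing_single qs_coeff_qsM)

lemma pairing_qsM: "pairing K (qsM \<alpha>) = Poly_Mapping.lookup K \<alpha>"
proof -
  have "pairing K (qsM \<alpha>) = (\<Sum>\<gamma>\<in>insert \<alpha> (Poly_Mapping.keys K).
      Poly_Mapping.lookup K \<gamma> * qs_coeff (qsM \<alpha>) \<gamma>)"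
    by (rule pairing_superset) auto
  also have "\<dots> = (\<Sum>\<gamma>\<in>insert \<alpha> (Poly_Mapping.keys K).
      if \<gamma> = \<alpha> then Poly_Mapping.lookup K \<gamma> else 0)"
    by (rule sum.cong) (simp_all add: qs_coeff_qsM)
  also have "\<dots> = Poly_Mapping.lookup K \<alpha>" by (simp add: sum.delta)
  finally show ?thesis .
qed

definition perp_explicit :: "series \<Rightarrow> nsym \<Rightarrow> nsym" where
  "perp_explicit F H = (\<Sum>\<beta>\<in>Poly_Mapping.keys H.
     \<Sum>(a, b) \<in> {(a, b). a + b = xmono [0..<length (parts \<beta>)] (parts \<beta>)}.
       Poly_Mapping.single (Composition (exps b)) (Poly_Mapping.lookup H \<beta> * F a))"

lemma pairing_perp_explicit:
  assumes "G \<in> QSym"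
  shows "pairing (perp_explicit F H) G = pairing H (mult_series F G)"
  unfolding perp_explicit_def pairing_sum case_prod_unfold pairing_single QSym_coeff[OF assms]
  by (simp add: pairing_def[of H] qs_coeff_def mult_series_def case_prod_unfold sum_distrib_left
      mult.assoc)

lemma ex1_perp: "\<exists>!K. \<forall>G\<in>QSym. pairing K G = pairing H (mult_series F G)"
proof (rule ex1I[of _ "perp_explicit F H"])
  fix K assume "\<forall>G\<in>QSym. pairing K G = pairing H (mult_series F G)"
  then have "pairing K (qsM \<alpha>) = pairing (perp_explicit F H) (qsM \<alpha>)" for \<alpha>
    by (simp add: pairing_perp_explicit qsM_QSym)
  then show "K = perp_explicit F H"
    by (intro poly_mapping_eqI) (simp add: pairing_qsM)
qed (simp add: pairing_perp_explicit)

lemma perp_eq: "perp F H = perp_explicit F H"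
  unfolding perp_def
  by (rule the1_equality[OF ex1_perp]) (simp add: pairing_perp_explicit)

lemma pairing_perp:
  "G \<in> QSym \<Longrightarrow> pairing (perp F H) G = pairing H (mult_series F G)"
  by (simp add: perp_eq pairing_perp_explicit)

lemma perp_zero: "perp F 0 = 0"
  by (simp add: perp_eq perp_explicit_def)

lemma finite_perp:
  assumes "\<And>i m. F i m \<noteq> 0 \<Longrightarrow> mdeg m = i"
  shows "finite {i. perp (F i) H \<noteq> 0}"
proof (rule finite_subset)
  let ?x = "\<lambda>\<beta>. xmono [0..<length (parts \<beta>)] (parts \<beta>)"
  show "finite (\<Union>\<beta>\<in>Poly_Mapping.keys H. {..mdeg (?x \<beta>)})" by simp
  show "{i. perp (F i) H \<noteq> 0} \<subseteq> (\<Union>\<beta>\<in>Poly_Mapping.keys H. {..mdeg (?x \<beta>)})"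
  proof (rule subsetI, rule ccontr)
    fix i assume i: "i \<in> {i. perp (F i) H \<noteq> 0}"
      and n: "i \<notin> (\<Union>\<beta>\<in>Poly_Mapping.keys H. {..mdeg (?x \<beta>)})"
    have "F i a = 0" if "\<beta> \<in> Poly_Mapping.keys H" "a + b = ?x \<beta>" for a b \<beta>
    proof (rule ccontr)
      assume "F i a \<noteq> 0"
      then have "mdeg a = i" by (rule assms)
      then have "i \<le> mdeg (?x \<beta>)" using mdeg_add[of a b] that by simp
      with n that show False by auto
    qed
    then have "perp_explicit (F i) H = 0"
      unfolding perp_explicit_def by (intro sum.neutral ballI) auto
    with i show False by (simp add: perp_eq)
  qed
qed

lemma scale_zero: "scale c 0 = 0"
  by (simp add: scale_def mult_map_scale_conv_mult)

lemma finite_opB: "finite {i. scale ((-1) ^ i) (ncH (m + int i) * perp (qsF_ones i) f) \<noteq> 0}"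
proof (rule finite_subset)
  show "finite {i. perp (qsF_ones i) f \<noteq> 0}"
  proof (rule finite_perp)
    fix i m assume "qsF_ones i m \<noteq> 0"
    then have "exps m = parts (Composition (replicate i 1))"
      by (simp add: qsF_ones_def qsM_eq split: if_splits)
    also have "\<dots> = replicate i 1"
      by (rule parts_Composition) simp
    finally show "mdeg m = i" by (simp add: mdeg_exps sum_list_replicate)
  qed
qed (auto simp: scale_zero)

lemma finite_opBt: "finite {i. scale (q ^ i) (opB (m + int i) (perp (qsF i) f)) \<noteq> 0}"
proof (rule finite_subset)
  show "finite {i. perp (qsF i) f \<noteq> 0}"
  proof (rule finite_perp)
    fix i m assume "qsF i m \<noteq> 0"
    then obtain \<gamma> where "sum_list (parts \<gamma>) = i" "qsM \<gamma> m \<noteq> 0"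
      unfolding qsF_def by (auto elim: sum.not_neutral_contains_not_neutral)
    then show "mdeg m = i" by (simp add: qsM_eq mdeg_exps split: if_splits)
  qed
qed (auto simp: opB_def perp_zero scale_zero)

lemma finite_compositions: "finite {\<gamma>. sum_list (parts \<gamma>) = i}"
proof (rule finite_imageD)
  have "length (parts \<gamma>) \<le> sum_list (parts \<gamma>)" for \<gamma>
  proof -
    have "(\<Sum>r\<leftarrow>parts \<gamma>. 1) \<le> (\<Sum>r\<leftarrow>parts \<gamma>. r)"
      using parts_pos[of _ \<gamma>] by (intro sum_list_mono) (auto simp: Suc_le_eq)
    then show ?thesis by (simp add: sum_list_triv)
  qed
  then have "parts ` {\<gamma>. sum_list (parts \<gamma>) = i} \<subseteq> {xs. set xs \<subseteq> {..i} \<and> length xs \<le> i}"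
    by (auto dest: member_le_sum_list)
  then show "finite (parts ` {\<gamma>. sum_list (parts \<gamma>) = i})"
    by (rule finite_subset) (rule finite_lists_length_le, simp)
qed (simp add: inj_on_def parts_inject)

end

theory Submission
  imports Defs "HOL-Computational_Algebra.Formal_Power_Series" "HOL-Library.Multiset"
begin

text \<open>
  The operator \<open>opBt m\<close> is the sum of $\pm q^i H_{m+i+j} F_{1^j}^\perp F_i^\perp$, that is, it combines
  the coefficients of \<open>\<Prod>\<^sub>k (1 - x\<^sub>k t) / (1 - q x\<^sub>k t)\<close> with the generators.  Multiplication by \<open>H\<^sub>m\<close>
  is therefore recovered as $\sum_n \widetilde{B}_{m+n} G_n^\perp$, with \<open>G\<^sub>n\<close> the coefficients of the
  inverse product \<open>\<Prod>\<^sub>k (1 - q x\<^sub>k t) / (1 - x\<^sub>k t) = \<Prod>\<^sub>k (1 + \<Sum>\<^sub>r (1 - q) x\<^sub>k\<^sup>r t\<^sup>r)\<close>.  On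
  \<open>H\<^sub>c\<^sub>1 H\<^sub>c\<^sub>2 \<dots>\<close> the adjoint of \<open>G\<^sub>n\<close> takes \<open>n\<close> boxes away from the indices \<open>c\<^sub>i\<close>, with a factor
  \<open>1 - q\<close> for every index that is changed.  The boxes taken away, together with the \<open>m\<close> smallest
  letters, form the first row of an immaculate tableau, whose remaining rows are any immaculate
  tableau with the content that is left.
\<close>

section \<open>Linearity\<close>

interpretation scale: module scale
proof
  fix a b :: ratfun and x y :: nsym
  show "scale a (x + y) = scale a x + scale a y"
    by (simp add: scale_def mult_map_scale_conv_mult distrib_left)
  show "scale (a + b) x = scale a x + scale b x"
    by (simp add: scale_def mult_map_scale_conv_mult single_add distrib_right)
  show "scale a (scale b x) = scale (a * b) x"
    by (simp add: scale_def mult_map_scale_conv_mult mult_single flip: mult.assoc)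
  show "scale 1 x = x"
    by (simp add: scale_def mult_map_scale_conv_mult)
qed

lemma lookup_scale: "Poly_Mapping.lookup (scale c f) \<alpha> = c * Poly_Mapping.lookup f \<alpha>"
  by (simp add: scale_def Poly_Mapping.map.rep_eq when_def)

lemma scale_single: "scale c (Poly_Mapping.single \<alpha> d) = Poly_Mapping.single \<alpha> (c * d)"
  by (simp add: scale_def mult_map_scale_conv_mult mult_single)

text \<open>Scalars sit on the neutral word \<open>0\<close>, so
  \<open>Poly_Mapping.single 0 c\<close> is central although the ring is not commutative.
  \<open>f\<close> is built up one word at a time.\<close>

lemma mult_scale_right: "f * scale c g = scale c (f * g)"
proof -
  have "f * Poly_Mapping.single 0 c = Poly_Mapping.single 0 c * f"
  proof (induction f rule: Poly_Mapping.update_induct)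
    case (update f \<alpha> d)
    have "Poly_Mapping.update \<alpha> d f = Poly_Mapping.single \<alpha> d + f"
      using update.hyps(1)
      by (intro poly_mapping_eqI) (auto simp: lookup_update lookup_add lookup_single in_keys_iff when_def)
    then show ?case
      using update.IH by (simp add: distrib_left distrib_right mult_single mult.commute)
  qed simp
  then show ?thesis
    by (simp add: scale_def mult_map_scale_conv_mult flip: mult.assoc)
qed

lemma pairing_scale: "pairing (scale c H) G = c * pairing H G"
proof -
  have "Poly_Mapping.keys (scale c H) \<subseteq> Poly_Mapping.keys H"
    by (auto simp: in_keys_iff lookup_scale)
  then show ?thesis
    by (subst pairing_superset[of "Poly_Mapping.keys H"])
      (simp_all add: pairing_def lookup_scale sum_distrib_left mult.assoc)
qed

text \<open>The \<open>qsM \<alpha>\<close> are dual to the words, so adjointness gives each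
  coefficient; linearity of \<open>perp F\<close> then comes from that of
  \<open>pairing\<close>.\<close>

lemma lookup_perp: "Poly_Mapping.lookup (perp F H) \<alpha> = pairing H (mult_series F (qsM \<alpha>))"
  by (simp add: pairing_perp qsM_QSym flip: pairing_qsM)

lemma perp_add: "perp F (H + K) = perp F H + perp F K"
  by (rule poly_mapping_eqI) (simp add: lookup_perp lookup_add pairing_add)

lemma perp_scale: "perp F (scale c H) = scale c (perp F H)"
  by (rule poly_mapping_eqI) (simp add: lookup_perp lookup_scale pairing_scale)

lemma scale_Sum_any:
  assumes "finite {i. f i \<noteq> 0}"
  shows "scale c (Sum_any f) = Sum_any (\<lambda>i. scale c (f i))"
proof -
  have "Sum_any (\<lambda>i. scale c (f i)) = (\<Sum>i\<in>{i. f i \<noteq> 0}. scale c (f i))"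
    by (rule Sum_any.expand_superset[OF assms]) auto
  then show ?thesis
    by (simp add: Sum_any.expand_set scale.scale_sum_right)
qed

lemma opB_add: "opB m (f + g) = opB m f + opB m g"
  unfolding opB_def
  by (simp add: perp_add distrib_left scale.scale_right_distrib Sum_any.distrib[OF finite_opB finite_opB])

lemma opB_scale: "opB m (scale c f) = scale c (opB m f)"
  unfolding opB_def
  by (simp add: perp_scale mult_scale_right scale_Sum_any[OF finite_opB] mult.commute)

lemma opB_zero: "opB m 0 = 0"
  by (simp add: opB_def perp_zero scale_zero)

lemma opB_sum: "opB m (sum f A) = (\<Sum>x\<in>A. opB m (f x))"
  by (induction A rule: infinite_finite_induct)
    (simp_all add: opB_add opB_zero)

lemma opBt_add: "opBt m (f + g) = opBt m f + opBt m g"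
  unfolding opBt_def
  by (simp add: perp_add opB_add scale.scale_right_distrib Sum_any.distrib[OF finite_opBt finite_opBt])

lemma opBt_scale: "opBt m (scale c f) = scale c (opBt m f)"
  unfolding opBt_def
  by (simp add: perp_scale opB_scale scale_Sum_any[OF finite_opBt] mult.commute)

lemma opBt_sum: "opBt m (sum f A) = (\<Sum>x\<in>A. opBt m (f x))"
  by (induction A rule: infinite_finite_induct)
    (simp_all add: opBt_add, simp_all add: opBt_def perp_zero opB_zero scale_zero)

section \<open>Adjoints of multiplication on products of generators\<close>

text \<open>These pairs index the factorizations of a monomial with exponents \<open>cs\<close>
  along a fixed list of variables. Zeros are allowed, so all lists keep one length.\<close>

definition splits :: "nat list \<Rightarrow> (nat list \<times> nat list) set" where
  "splits cs = {(ks, ls). length ks = length ls \<and> map2 (+) ks ls = cs}"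

lemma splits_Nil: "splits [] = {([], [])}"
  by (auto simp: splits_def)

lemma splits_Cons:
  "splits (c # cs) = (\<lambda>(k, ks, ls). (k # ks, (c - k) # ls)) ` ({..c} \<times> splits cs)"
proof -
  have "(ks, ls) \<in> (\<lambda>(k, ks, ls). (k # ks, (c - k) # ls)) ` ({..c} \<times> splits cs)"
    if kl: "length ks = length ls" "map2 (+) ks ls = c # cs" for ks ls
  proof -
    obtain k ks' l ls' where "ks = k # ks'" "ls = l # ls'" "k + l = c" "map2 (+) ks' ls' = cs"
        "length ks' = length ls'"
      using kl by (cases ks; cases ls) auto
    then show ?thesis
      by (intro image_eqI[of _ _ "(k, ks', ls')"]) (auto simp: splits_def)
  qed
  then show ?thesis
    by (auto simp: splits_def)
qed

lemma finite_splits: "finite (splits cs)"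
  by (induction cs) (simp_all add: splits_Nil splits_Cons)

lemma sum_splits_Cons:
  "(\<Sum>(ks, ls)\<in>splits (c # cs). g ks ls) =
     (\<Sum>k\<le>c. \<Sum>(ks, ls)\<in>splits cs. g (k # ks) ((c - k) # ls))"
proof -
  have "inj_on (\<lambda>(k, ks, ls). (k # ks, (c - k) # ls)) ({..c} \<times> splits cs)"
    by (auto simp: inj_on_def)
  then show ?thesis
    unfolding splits_Cons
    by (simp add: sum.reindex sum.cartesian_product case_prod_unfold)
qed

lemma splits_sum_list_le: "(ks, ls) \<in> splits cs \<Longrightarrow> sum_list ks \<le> sum_list cs"
  by (induction cs arbitrary: ks ls) (auto simp: splits_Nil splits_Cons intro!: add_mono)

lemma splits_length:
  assumes "(ks, ls) \<in> splits cs"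
  shows "length ks = length cs" "length ls = length cs"
  using assms by (auto simp: splits_def)

lemma sum_list_filter_pos: "sum_list (filter ((<) 0) ks) = sum_list (ks :: nat list)"
  by (induction ks) auto

text \<open>Where \<open>cs\<close> has a zero both summands are zero and vanish under the filter.
  This passes between compositions and lists with zeros.\<close>

lemma sum_splits_filter:
  "(\<Sum>(ks, ls)\<in>splits (filter ((<) 0) cs). g (filter ((<) 0) ks) (filter ((<) 0) ls)) =
     (\<Sum>(ks, ls)\<in>splits cs. g (filter ((<) 0) ks) (filter ((<) 0) ls))"
proof (induction cs arbitrary: g)
  case Nil
  show ?case by simp
next
  case (Cons c cs)
  show ?case
  proof (cases "c = 0")
    case True
    then show ?thesis
      by (simp add: sum_splits_Cons Cons)
  next
    case False
    have "(\<Sum>(ks, ls)\<in>splits (filter ((<) 0) cs).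
          g (filter ((<) 0) (k # ks)) (filter ((<) 0) (l # ls))) =
        (\<Sum>(ks, ls)\<in>splits cs.
          g (filter ((<) 0) (k # ks)) (filter ((<) 0) (l # ls)))" for k l
      using Cons[of "\<lambda>u v. g (filter ((<) 0) [k] @ u) (filter ((<) 0) [l] @ v)"]
      by (simp only: filter_append[symmetric] append.simps)
    moreover have "filter ((<) 0) (c # cs) = c # filter ((<) 0) cs"
      using False by simp
    ultimately show ?thesis
      by (simp only: sum_splits_Cons)
  qed
qed

text \<open>Unlike in a composition, zeros are allowed: they appear when an index is used up and
  contribute the factor \<open>1\<close>.\<close>

definition hprod :: "nat list \<Rightarrow> nsym" where
  "hprod cs = prod_list (map (\<lambda>b. ncH (int b)) cs)"

lemma hprod_Cons [simp]: "hprod (c # cs) = ncH (int c) * hprod cs"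
  by (simp add: hprod_def)

lemma hprod_filter: "hprod (filter ((<) 0) cs) = hprod cs"
  by (induction cs) (auto simp: hprod_def ncH_def)

lemma hprod_single: "hprod cs = Poly_Mapping.single (Composition (filter ((<) 0) cs)) 1"
proof -
  have "parts (Composition (filter ((<) 0) cs)) = filter ((<) 0) cs"
    by (rule parts_Composition) auto
  then have "hprod (filter ((<) 0) cs) = ncH_comp (Composition (filter ((<) 0) cs))"
    by (simp add: hprod_def ncH_comp_def)
  then show ?thesis
    by (simp only: ncH_comp_eq_single hprod_filter)
qed

section \<open>Monomials along a fixed list of variables\<close>

lemma xmono_add:
  "length is = length ks \<Longrightarrow> length ks = length ls \<Longrightarrow>
     xmono is (map2 (+) ks ls) = xmono is ks + xmono is ls"
  by (induction "is" ks ls rule: list_induct3) (auto simp: xmono_def single_add add_ac)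

lemma keys_xmono_subset: "Poly_Mapping.keys (xmono is ks) \<subseteq> set is"
proof (induction "is" arbitrary: ks)
  case Nil
  show ?case by (simp add: xmono_def)
next
  case (Cons i "is")
  show ?case
  proof (cases ks)
    case Nil
    then show ?thesis by (simp add: xmono_def)
  next
    case (Cons k ks')
    have "Poly_Mapping.keys (xmono (i # is) ks) \<subseteq>
        Poly_Mapping.keys (Poly_Mapping.single i k) \<union> Poly_Mapping.keys (xmono is ks')"
      using keys_add[of "Poly_Mapping.single i k" "xmono is ks'"] by (simp add: Cons xmono_def)
    moreover have "Poly_Mapping.keys (Poly_Mapping.single i k) \<subseteq> {i}"
      by simp
    ultimately show ?thesis
      using Cons.IH[of ks'] by (simp only: list.set) blast
  qed
qed

lemma map_lookup_xmono:
  "length is = length ks \<Longrightarrow> distinct is \<Longrightarrow> map (Poly_Mapping.lookup (xmono is ks)) is = ks"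
proof (induction "is" ks rule: list_induct2)
  case (Cons i "is" k ks)
  have l: "Poly_Mapping.lookup (xmono is ks) i = 0"
    using keys_xmono_subset[of "is" ks] Cons.prems by (auto simp: in_keys_iff)
  have e: "xmono (i # is) (k # ks) = Poly_Mapping.single i k + xmono is ks"
    by (simp add: xmono_def)
  have "map (Poly_Mapping.lookup (xmono (i # is) (k # ks))) is =
      map (Poly_Mapping.lookup (xmono is ks)) is"
    using Cons.prems by (intro map_cong) (auto simp: e lookup_add lookup_single when_def)
  moreover have "Poly_Mapping.lookup (xmono (i # is) (k # ks)) i = k"
    by (simp add: e lookup_add l)
  ultimately show ?case
    using Cons by (simp del: map_eq_conv)
qed simp

lemma xmono_map_lookup:
  assumes "distinct is" "Poly_Mapping.keys m \<subseteq> set is"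
  shows "xmono is (map (Poly_Mapping.lookup m) is) = m"
proof (rule poly_mapping_eqI)
  fix j
  show "Poly_Mapping.lookup (xmono is (map (Poly_Mapping.lookup m) is)) j = Poly_Mapping.lookup m j"
  proof (cases "j \<in> set is")
    case True
    then show ?thesis
      using map_lookup_xmono[of "is" "map (Poly_Mapping.lookup m) is"] assms(1) by simp
  next
    case False
    then show ?thesis
      using keys_xmono_subset[of "is" "map (Poly_Mapping.lookup m) is"] assms(2)
      by (metis in_keys_iff subsetD)
  qed
qed

lemma exps_xmono_weak:
  assumes "sorted_wrt (<) is" "length is = length ks"
  shows "exps (xmono is ks) = filter ((<) 0) ks"
proof -
  let ?m = "xmono is ks"
  have d: "distinct is"
    using assms(1) by (simp add: strict_sorted_iff)
  have "Poly_Mapping.keys ?m = set (filter (\<lambda>i. Poly_Mapping.lookup ?m i \<noteq> 0) is)"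
    using keys_xmono_subset[of "is" ks] by (auto simp: in_keys_iff)
  moreover have "sorted_list_of_set (set (filter (\<lambda>i. Poly_Mapping.lookup ?m i \<noteq> 0) is)) =
      filter (\<lambda>i. Poly_Mapping.lookup ?m i \<noteq> 0) is"
    using assms(1) by (intro sorted_list_of_set.idem_if_sorted_distinct)
      (simp_all add: strict_sorted_iff sorted_wrt_filter)
  ultimately have "exps ?m = map (Poly_Mapping.lookup ?m) (filter (\<lambda>i. Poly_Mapping.lookup ?m i \<noteq> 0) is)"
    by (simp add: exps_def)
  also have "\<dots> = filter ((<) 0) (map (Poly_Mapping.lookup ?m) is)"
    by (auto simp: filter_map o_def intro!: arg_cong[where f = "map _"] filter_cong)
  finally show ?thesis
    by (simp add: map_lookup_xmono assms(2) d)
qed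

lemma sum_xmono_splits:
  assumes "distinct is" "length is = length cs"
  shows "(\<Sum>(a, b)\<in>{(a, b). a + b = xmono is cs}. g a b) =
    (\<Sum>(ks, ls)\<in>splits cs. g (xmono is ks) (xmono is ls))"
proof -
  let ?f = "\<lambda>(ks, ls). (xmono is ks, xmono is ls)"
  have inj: "inj_on ?f (splits cs)"
  proof (rule inj_onI, clarify)
    fix ks ls ks' ls'
    assume "(ks, ls) \<in> splits cs" "(ks', ls') \<in> splits cs"
      and "xmono is ks = xmono is ks'" "xmono is ls = xmono is ls'"
    then show "ks = ks' \<and> ls = ls'"
      using assms by (metis map_lookup_xmono splits_length)
  qed
  have "(a, b) \<in> ?f ` splits cs" if ab: "a + b = xmono is cs" for a b
  proof -
    \<comment> \<open>Exponents are natural numbers, so nothing cancels and both factors use only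
      variables in \<open>is\<close>.\<close>
    have sub: "Poly_Mapping.keys a \<subseteq> set is" "Poly_Mapping.keys b \<subseteq> set is"
      using keys_xmono_subset[of "is" cs] unfolding ab[symmetric]
      by (auto simp: in_keys_iff lookup_add)
    have "map2 (+) (map (Poly_Mapping.lookup a) is) (map (Poly_Mapping.lookup b) is) =
        map (Poly_Mapping.lookup (a + b)) is"
      by (simp add: lookup_add map2_map_map)
    then have "(map (Poly_Mapping.lookup a) is, map (Poly_Mapping.lookup b) is) \<in> splits cs"
      using assms by (simp add: splits_def ab map_lookup_xmono)
    then show ?thesis
      using sub assms(1)
      by (intro image_eqI[of _ _ "(map (Poly_Mapping.lookup a) is, map (Poly_Mapping.lookup b) is)"])
        (simp_all add: xmono_map_lookup)
  qed
  moreover have "?f ` splits cs \<subseteq> {(a, b). a + b = xmono is cs}"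
    using assms(2) by (auto simp: splits_def xmono_add)
  ultimately have "{(a, b). a + b = xmono is cs} = ?f ` splits cs"
    by auto
  then show ?thesis
    using inj by (simp add: sum.reindex case_prod_unfold)
qed

text \<open>The coproduct splits every index of the product as \<open>k + l\<close>; pairing the
  left tensor factor with \<open>F\<close> leaves the generators with indices \<open>ls\<close>. As
  for quasisymmetric functions, the coefficients of \<open>F\<close> depend on exponent sequences
  only.\<close>

lemma perp_hprod:
  assumes "\<And>a. F a = \<phi> (exps a)"
  shows "perp F (hprod cs) =
    (\<Sum>(ks, ls)\<in>splits cs. scale (\<phi> (filter ((<) 0) ks)) (hprod ls))"
proof -
  let ?cs = "filter ((<) 0) cs" and ?is = "[0..<length (filter ((<) 0) cs)]"
  have p: "parts (Composition ?cs) = ?cs"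
    by (rule parts_Composition) auto
  have "perp F (hprod cs) = (\<Sum>(a, b)\<in>{(a, b). a + b = xmono ?is ?cs}.
      Poly_Mapping.single (Composition (exps b)) (\<phi> (exps a)))"
    unfolding perp_eq perp_explicit_def hprod_single by (simp add: p assms)
  also have "\<dots> = (\<Sum>(ks, ls)\<in>splits ?cs.
      Poly_Mapping.single (Composition (exps (xmono ?is ls))) (\<phi> (exps (xmono ?is ks))))"
    by (rule sum_xmono_splits) auto
  also have "\<dots> = (\<Sum>(ks, ls)\<in>splits ?cs. 
      scale (\<phi> (filter ((<) 0) ks)) (Poly_Mapping.single (Composition (filter ((<) 0) ls)) 1))"
    by (rule sum.cong) (auto simp: exps_xmono_weak splits_length scale_single)
  also have "\<dots> = (\<Sum>(ks, ls)\<in>splits cs. 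
      scale (\<phi> (filter ((<) 0) ks)) (Poly_Mapping.single (Composition (filter ((<) 0) ls)) 1))"
    by (rule sum_splits_filter)
  finally show ?thesis
    by (simp add: hprod_single)
qed

text \<open>Each monomial occurs in exactly one \<open>qsM \<gamma>\<close>, the one given by its
  exponent sequence.\<close>

lemma qsF_exps: "qsF i m = (if sum_list (exps m) = i then 1 else 0)"
proof -
  have "qsM \<gamma> m = (if \<gamma> = Composition (exps m) then 1 else 0)" for \<gamma>
    unfolding qsM_eq by (metis exps_pos parts_Composition parts_inverse)
  moreover have "parts (Composition (exps m)) = exps m"
    by (rule parts_Composition) (rule exps_pos)
  ultimately show ?thesis
    by (simp add: qsF_def finite_compositions)
qed

lemma qsF_ones_exps: "qsF_ones i m = (if exps m = replicate i 1 then 1 else 0)"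
proof -
  have "parts (Composition (replicate i 1)) = replicate i 1"
    by (rule parts_Composition) simp
  then show ?thesis
    by (simp add: qsF_ones_def qsM_eq)
qed

text \<open>
  The generating series \<open>\<Prod>\<^sub>i a(x\<^sub>i t)\<close> acts by \<open>perp\<close> on a product of generators by distributing a
  total degree \<open>n\<close> over the factors; \<open>g n\<close> is then applied to what is left of them.
\<close>

definition expand :: "ratfun fps \<Rightarrow> nat list \<Rightarrow> (nat \<Rightarrow> nat list \<Rightarrow> nsym) \<Rightarrow> nsym" where
  "expand a cs g =
     (\<Sum>(ks, ls)\<in>splits cs. scale (prod_list (map (fps_nth a) ks)) (g (sum_list ks) ls))"

lemma expand_Nil: "expand a [] g = g 0 []"
  by (simp add: expand_def splits_Nil)

lemma expand_Cons:
  "expand a (c # cs) g =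
     (\<Sum>k\<le>c. scale (fps_nth a k) (expand a cs (\<lambda>n ls. g (k + n) ((c - k) # ls))))"
  unfolding expand_def
  by (subst sum_splits_Cons) (simp add: scale.scale_sum_right case_prod_unfold)

lemma expand_sum_scale:
  "expand a cs (\<lambda>n ls. \<Sum>x\<in>A. scale (c x) (g x n ls)) = (\<Sum>x\<in>A. scale (c x) (expand a cs (g x)))"
  unfolding expand_def scale.scale_sum_right case_prod_unfold
  by (subst sum.swap) (simp add: mult.commute)

text \<open>Taking \<open>i\<close> and then \<open>j\<close> from one index has weight
  \<open>fps_nth a i * fps_nth b j\<close>; the sum over \<open>i + j = k\<close> is the Cauchy
  product.\<close>

lemma expand_mult: "expand a cs (\<lambda>n ls. expand b ls (\<lambda>m. g (n + m))) = expand (a * b) cs g"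
proof (induction cs arbitrary: g)
  case Nil
  show ?case by (simp add: expand_Nil)
next
  case (Cons c cs)
  let ?h = "\<lambda>i j. scale (fps_nth a i * fps_nth b j)
    (expand (a * b) cs (\<lambda>n ls. g (i + j + n) ((c - (i + j)) # ls)))"
  have IH: "expand a cs (\<lambda>n ls. expand b ls (\<lambda>m ms. g (i + n + (j + m)) ((c - i - j) # ms))) =
      expand (a * b) cs (\<lambda>n ls. g (i + j + n) ((c - (i + j)) # ls))" for i j
    using Cons[of "\<lambda>n ls. g (i + j + n) ((c - (i + j)) # ls)"] by (simp add: add_ac)
  have "expand a (c # cs) (\<lambda>n ls. expand b ls (\<lambda>m. g (n + m))) = (\<Sum>i\<le>c. \<Sum>j\<le>c - i. ?h i j)"
    by (simp add: expand_Cons expand_sum_scale scale.scale_sum_right IH[simplified])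
  also have "\<dots> = (\<Sum>(i, j)\<in>{(i, j). i + j \<le> c}. ?h i j)"
    by (subst sum.Sigma) (auto intro!: sum.cong)
  also have "\<dots> = (\<Sum>k\<le>c. \<Sum>i\<le>k. ?h i (k - i))"
    by (rule sum.triangle_reindex_eq)
  also have "\<dots> = expand (a * b) (c # cs) g"
    by (simp add: expand_Cons fps_mult_nth atMost_atLeast0 scale.scale_sum_left)
  finally show ?case .
qed

lemma expand_one: "expand 1 cs g = g 0 cs"
proof (induction cs arbitrary: g)
  case (Cons c cs)
  have "expand 1 (c # cs) g = (\<Sum>k\<le>c. if k = 0 then g 0 (c # cs) else 0)"
    unfolding expand_Cons by (rule sum.cong) (simp_all add: Cons)
  then show ?case by simp
qed (simp add: expand_Nil)

section \<open>Creation operators as factorwise series\<close>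

lemma prod_list_geometric:
  "prod_list (map (fps_nth (Abs_fps (\<lambda>i. c ^ i))) ks) = (c :: ratfun) ^ sum_list ks"
  by (induction ks) (simp_all add: power_add)

text \<open>A split contributes only at the degree \<open>i = sum_list ks\<close>, which is at most
  \<open>sum_list cs\<close>; the sum over \<open>i\<close> is thus finite and can be exchanged with
  the sum over splits.\<close>

lemma Sum_any_splits:
  assumes "\<And>i. f i = (\<Sum>(ks, ls)\<in>splits cs. g i ks ls)"
    and "\<And>i ks ls. i \<noteq> sum_list ks \<Longrightarrow> g i ks ls = 0"
  shows "Sum_any f = (\<Sum>(ks, ls)\<in>splits cs. g (sum_list ks) ks ls :: nsym)"
proof -
  have "f i = 0" if "i > sum_list cs" for i
    unfolding assms(1) using that by (intro sum.neutral) (auto intro!: assms(2) dest!: splits_sum_list_le)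
  then have "Sum_any f = (\<Sum>i\<le>sum_list cs. f i)"
    by (intro Sum_any.expand_superset) (auto simp: not_less[symmetric])
  also have "\<dots> = (\<Sum>(ks, ls)\<in>splits cs. \<Sum>i\<le>sum_list cs. g i ks ls)"
    unfolding assms(1) case_prod_unfold by (rule sum.swap)
  also have "\<dots> = (\<Sum>(ks, ls)\<in>splits cs. g (sum_list ks) ks ls)"
  proof (rule sum.cong, simp, clarify)
    fix ks ls assume "(ks, ls) \<in> splits cs"
    then have "sum_list ks \<le> sum_list cs"
      by (rule splits_sum_list_le)
    moreover have "(\<Sum>i\<le>sum_list cs. g i ks ls) =
        (\<Sum>i\<le>sum_list cs. if i = sum_list ks then g (sum_list ks) ks ls else 0)"
      by (rule sum.cong) (auto simp: assms(2))
    ultimately show "(\<Sum>i\<le>sum_list cs. g i ks ls) = g (sum_list ks) ks ls"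
      by simp
  qed
  finally show ?thesis .
qed

text \<open>The series has coefficients \<open>1, -1, 0, 0, ...\<close>, so the product survives
  only if all entries are at most 1. The condition has the form that \<open>qsF_ones_exps\<close>
  produces.\<close>

lemma prod_list_one_minus_X:
  "prod_list (map (fps_nth (1 - fps_X)) ks) =
     (if filter ((<) 0) ks = replicate (sum_list ks) 1 then (-1) ^ sum_list ks else (0 :: ratfun))"
proof (induction ks)
  case (Cons k ks)
  have big: "filter ((<) 0) ks \<noteq> replicate n 1" if "n > sum_list ks" for n
  proof
    assume *: "filter ((<) 0) ks = replicate n 1"
    then show False
      using that sum_list_filter_pos[of ks] by (simp add: sum_list_replicate)
  qed
  consider "k = 0" | "k = 1" | k' where "k = Suc (Suc k')"
    by (cases k rule: nat.exhaust; metis One_nat_def nat.exhaust)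
  then show ?case
    using Cons by cases (auto simp: replicate_Suc)
qed simp

text \<open>The signed sum of the \<open>qsF_ones i\<close>, with \<open>t\<close> marking the
  degree, is the product of all \<open>1 - x_k t\<close>, so \<open>1 - fps_X\<close> acts on each
  index.\<close>

lemma opB_hprod:
  "opB m (hprod cs) = expand (1 - fps_X) cs (\<lambda>n ls. ncH (m + int n) * hprod ls)"
proof -
  let ?\<phi> = "\<lambda>i ks. if ks = replicate i 1 then 1 else (0 :: ratfun)"
  let ?g = "\<lambda>i ks ls. scale ((-1) ^ i * ?\<phi> i (filter ((<) 0) ks)) (ncH (m + int i) * hprod ls)"
  have "i = sum_list ks" if "filter ((<) 0) ks = replicate i 1" for i ks
    using that sum_list_filter_pos[of ks] by (simp add: sum_list_replicate)
  then have "opB m (hprod cs) = (\<Sum>(ks, ls)\<in>splits cs. ?g (sum_list ks) ks ls)"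
    unfolding opB_def perp_hprod[where \<phi> = "?\<phi> _", OF qsF_ones_exps]
    by (intro Sum_any_splits)
      (auto simp: sum_distrib_left scale.scale_sum_right mult_scale_right case_prod_unfold)
  also have "\<dots> = expand (1 - fps_X) cs (\<lambda>n ls. ncH (m + int n) * hprod ls)"
    unfolding expand_def by (intro sum.cong) (simp_all add: prod_list_one_minus_X case_prod_unfold)
  finally show ?thesis .
qed

text \<open>The sum of all \<open>(q t)^i * qsF i\<close> is the product of all
  \<open>1 / (1 - q x_k t)\<close>, hence the geometric series.\<close>

lemma opBt_hprod:
  "opBt m (hprod cs) = expand (Abs_fps (\<lambda>i. q ^ i)) cs (\<lambda>n ls. opB (m + int n) (hprod ls))"
proof -
  let ?\<phi> = "\<lambda>i ks. if sum_list ks = i then 1 else (0 :: ratfun)"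
  let ?g = "\<lambda>i ks ls. scale (q ^ i * ?\<phi> i (filter ((<) 0) ks)) (opB (m + int i) (hprod ls))"
  have "opBt m (hprod cs) = (\<Sum>(ks, ls)\<in>splits cs. ?g (sum_list ks) ks ls)"
    unfolding opBt_def perp_hprod[where \<phi> = "?\<phi> _", OF qsF_exps]
    by (intro Sum_any_splits)
      (auto simp: sum_list_filter_pos opB_sum opB_scale scale.scale_sum_right case_prod_unfold)
  also have "\<dots> = expand (Abs_fps (\<lambda>i. q ^ i)) cs (\<lambda>n ls. opB (m + int n) (hprod ls))"
    unfolding expand_def by (intro sum.cong) (simp_all add: prod_list_geometric sum_list_filter_pos case_prod_unfold)
  finally show ?thesis .
qed

section \<open>Inverting the creation operator\<close>

lemma geometric_fps: "(1 - fps_const c * fps_X) * Abs_fps (\<lambda>i. c ^ i) = (1 :: ratfun fps)"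
proof (rule fps_ext)
  fix n
  show "fps_nth ((1 - fps_const c * fps_X) * Abs_fps (\<lambda>i. c ^ i)) n = fps_nth (1 :: ratfun fps) n"
    by (cases n) (simp_all add: left_diff_distrib mult.assoc)
qed

text \<open>This is \<open>(1 - q X) / (1 - X)\<close>; its coefficients are the source of the
  weight \<open>1 - q\<close> for each changed index.\<close>

lemma fps_nth_ratio:
  "fps_nth ((1 - fps_const q * fps_X) * Abs_fps (\<lambda>i. 1)) = (\<lambda>k. if k = 0 then 1 else 1 - q)"
proof
  fix k
  show "fps_nth ((1 - fps_const q * fps_X) * Abs_fps (\<lambda>i. 1)) k = (if k = 0 then 1 else 1 - q)"
    by (cases k) (simp_all add: left_diff_distrib mult.assoc)
qed

text \<open>The series is inverse to the product of the two series that make up \<open>opBt\<close>,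
  so composing all three leaves only the term where nothing is taken away.\<close>

lemma ncH_mult_hprod:
  "ncH (int m) * hprod cs =
     expand ((1 - fps_const q * fps_X) * Abs_fps (\<lambda>i. 1)) cs (\<lambda>n ls. opBt (int (m + n)) (hprod ls))"
  (is "_ = expand ?a _ _")
proof -
  let ?b = "Abs_fps (\<lambda>i. q ^ i)"
  \<comment> \<open>Grouped into two inverse pairs, \<open>geometric_fps\<close> for
    \<open>q\<close> and for \<open>1\<close>.\<close>
  have "?a * ?b * (1 - fps_X) =
      ((1 - fps_const q * fps_X) * ?b) * ((1 - fps_const 1 * fps_X) * Abs_fps (\<lambda>i. 1 ^ i))"
    by (simp add: mult_ac)
  then have *: "?a * ?b * (1 - fps_X) = 1"
    by (simp only: geometric_fps mult_1)
  \<comment> \<open>Written as a function of \<open>n + n'\<close>, the total taken so far, the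
    inner term has the form that \<open>expand_mult\<close> needs.\<close>
  have "expand ?a cs (\<lambda>n ls. opBt (int (m + n)) (hprod ls)) =
      expand ?a cs (\<lambda>n ls. expand ?b ls
        (\<lambda>n'. (\<lambda>i ls. expand (1 - fps_X) ls (\<lambda>j ms. ncH (int (m + (i + j))) * hprod ms)) (n + n')))"
    by (simp add: opBt_hprod opB_hprod add_ac)
  also have "\<dots> = expand (?a * ?b * (1 - fps_X)) cs (\<lambda>n ls. ncH (int (m + n)) * hprod ls)"
    by (subst expand_mult, rule expand_mult)
  finally show ?thesis
    by (simp add: * expand_one)
qed


section \<open>Removing the first row of a tableau\<close>

text \<open>
  \<open>content_row s ks\<close> is the weakly increasing word with \<open>ks ! i\<close> letters \<open>s + i\<close>.  Zero entries and
  a variable first letter allow the rows below the first one to be treated as a tableau again.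
\<close>

fun content_row :: "nat \<Rightarrow> nat list \<Rightarrow> nat list" where
  "content_row s [] = []"
| "content_row s (k # ks) = replicate k s @ content_row (Suc s) ks"

section \<open>Words with prescribed multiplicities\<close>

lemma count_content_row:
  "count_list (content_row s ks) x = (if s \<le> x \<and> x < s + length ks then ks ! (x - s) else 0)"
proof (induction ks arbitrary: s)
  case (Cons k ks)
  have "count_list (replicate k s) x = (if x = s then k else 0)"
    by (induction k) auto
  moreover have "x - s = Suc (x - Suc s)" if "x > s"
    using that by simp
  ultimately show ?case
    using Cons[of "Suc s"] by (cases x s rule: linorder_cases) auto
qed simp

lemma set_content_row: "set (content_row s ks) \<subseteq> {s..<s + length ks}"
  by (induction ks arbitrary: s) fastforce+

lemma sorted_content_row: "sorted (content_row s ks)"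
proof (induction ks arbitrary: s)
  case (Cons k ks)
  then show ?case
    using set_content_row[of "Suc s" ks] by (fastforce simp: sorted_append)
qed simp

lemma length_content_row: "length (content_row s ks) = sum_list ks"
  by (induction ks arbitrary: s) auto

lemma card_content_row: "card (set (content_row s ks)) = length (filter ((<) 0) ks)"
proof (induction ks arbitrary: s)
  case (Cons k ks)
  have "s \<notin> set (content_row (Suc s) ks)"
    using set_content_row[of "Suc s" ks] by auto
  then show ?case
    using Cons by (cases "k = 0") simp_all
qed simp

lemma mset_content_row_inject:
  assumes "mset (content_row s ks) = mset (content_row s ls)" "length ks = length ls"
  shows "ks = ls"
proof (rule nth_equalityI[OF assms(2)])
  fix i assume "i < length ks"
  then show "ks ! i = ls ! i"
    using count_content_row[of s ks "s + i"] count_content_row[of s ls "s + i"] assms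
    by (simp flip: count_mset)
qed

lemma mset_content_row_add:
  "length ks = length ls \<Longrightarrow>
     mset (content_row s (map2 (+) ks ls)) = mset (content_row s ks) + mset (content_row s ls)"
  by (induction ks ls arbitrary: s rule: list_induct2)
    (simp_all add: replicate_add mset_append[symmetric] del: mset_append, simp add: ac_simps)

lemma mset_eq_content_row:
  assumes "set xs \<subseteq> {s..<s + n}"
  obtains ks where "length ks = n" "mset xs = mset (content_row s ks)"
proof
  let ?ks = "map (\<lambda>i. count_list xs (s + i)) [0..<n]"
  show "length ?ks = n" by simp
  show "mset xs = mset (content_row s ?ks)"
  proof (rule multiset_eqI)
    fix x
    show "count (mset xs) x = count (mset (content_row s ?ks)) x"
      using assms by (auto simp: count_mset count_content_row count_list_0_iff)
  qed
qed

definition tableaux :: "nat \<Rightarrow> nat list \<Rightarrow> nat list list set" where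
  "tableaux s cs = {T. immaculate_tableau T \<and> mset (concat T) = mset (content_row s cs)}"

lemma has_content_iff: "has_content T \<beta> \<longleftrightarrow> mset (concat T) = mset (content_row 1 (parts \<beta>))"
proof
  assume T: "has_content T \<beta>"
  show "mset (concat T) = mset (content_row 1 (parts \<beta>))"
  proof (rule multiset_eqI)
    fix x
    show "count (mset (concat T)) x = count (mset (content_row 1 (parts \<beta>))) x"
      using T unfolding has_content_def count_mset count_content_row
      by (cases "x \<in> {1..length (parts \<beta>)}") (auto simp: count_list_0_iff)
  qed
next
  assume T: "mset (concat T) = mset (content_row 1 (parts \<beta>))"
  have "set (concat T) \<subseteq> {1..length (parts \<beta>)}"
    using set_content_row[of 1 "parts \<beta>"] mset_eq_setD[OF T] by auto
  moreover have "count_list (concat T) i = count_list (content_row 1 (parts \<beta>)) i" for i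
    using T by (simp flip: count_mset)
  ultimately show "has_content T \<beta>"
    by (simp add: has_content_def count_content_row)
qed

lemma tableaux_Nil: "tableaux s [] = {[]}"
proof -
  have "T = []" if "immaculate_tableau T" "mset (concat T) = {#}" for T
    using that by (cases T) (auto simp: immaculate_tableau_def)
  then show ?thesis
    by (auto simp: tableaux_def immaculate_tableau_def)
qed

lemma tableaux_zero: "tableaux s (0 # cs) = tableaux (Suc s) cs"
  by (simp add: tableaux_def)

text \<open>Lower rows start with larger letters and increase weakly, so all \<open>m\<close> copies
  of the smallest letter \<open>s\<close> lie in the first row. Its other letters are free: as
  \<open>m > 0\<close> it still starts with \<open>s\<close>, and any tableau in larger letters fits
  below.\<close>

lemma tableaux_Cons:
  assumes s: "0 < s" and m: "0 < m"
  shows "tableaux s (m # cs) = (\<lambda>((ks, ls), T). (replicate m s @ content_row (Suc s) ks) # T) `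
    (SIGMA (ks, ls):splits cs. tableaux (Suc s) ls)" (is "_ = ?f ` ?S")
proof (intro equalityI subsetI)
  fix U assume "U \<in> ?f ` ?S"
  then obtain ks ls T where kl: "(ks, ls) \<in> splits cs" and T: "T \<in> tableaux (Suc s) ls"
    and U: "U = (replicate m s @ content_row (Suc s) ks) # T"
    by auto
  have "mset (concat U) = mset (content_row s (m # cs))"
    using kl T mset_content_row_add[of ks ls "Suc s"] by (auto simp: U splits_def tableaux_def)
  \<comment> \<open>The first column stays strictly increasing, since all letters of
    \<open>T\<close> exceed the \<open>s\<close> that starts the new row.\<close>
  moreover have "set (concat T) \<subseteq> {Suc s..}"
    using T set_content_row[of "Suc s" ls] mset_eq_setD[of "concat T" "content_row (Suc s) ls"]
    by (auto simp: tableaux_def)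
  then have "s < hd r" if "r \<in> set T" for r
    using that T by (cases r) (force simp: tableaux_def immaculate_tableau_def)+
  moreover have "sorted (replicate m s @ content_row (Suc s) ks)"
      "\<forall>x\<in>set (content_row (Suc s) ks). 0 < x"
    using sorted_content_row[of s "m # ks"] set_content_row[of "Suc s" ks] by auto
  ultimately show "U \<in> tableaux s (m # cs)"
    using T s m by (simp add: tableaux_def immaculate_tableau_def U hd_append)
next
  fix U assume U: "U \<in> tableaux s (m # cs)"
  then have imm: "immaculate_tableau U" and cont: "mset (concat U) = mset (content_row s (m # cs))"
    by (auto simp: tableaux_def)
  have set: "set (concat U) \<subseteq> {s..<s + Suc (length cs)}"
    using set_content_row[of s "m # cs"] mset_eq_setD[OF cont] by auto
  have sU: "s \<in> set (concat U)"
    using mset_eq_setD[OF cont] m by auto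
  then obtain r T where rT: "U = r # T"
    by (cases U) auto
  have r: "r \<noteq> []" "sorted r" and T: "immaculate_tableau T"
    and hd: "\<And>r'. r' \<in> set T \<Longrightarrow> hd r < hd r'"
    using imm by (auto simp: rT immaculate_tableau_def)
  have "s \<le> hd r"
    using set r(1) by (cases r) (auto simp: rT)
  have gt: "s < x" if x: "x \<in> set (concat T)" for x
  proof -
    obtain r' where r': "r' \<in> set T" "x \<in> set r'"
      using x by auto
    moreover have "sorted r'"
      using T r'(1) by (simp add: immaculate_tableau_def)
    ultimately have "hd r' \<le> x"
      by - (cases r', auto)
    then show ?thesis
      using hd[OF r'(1)] \<open>s \<le> hd r\<close> by simp
  qed
  \<comment> \<open>What the first row has besides the copies of \<open>s\<close>; its letter counts
    give \<open>ks\<close>.\<close>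
  define r' where "r' = filter (\<lambda>x. x \<noteq> s) r"
  have r_eq: "mset r = replicate_mset m s + mset r'"
  proof -
    have "count_list r s = count_list (concat U) s"
      using gt by (auto simp: rT count_list_0_iff)
    also have "\<dots> = m"
      using count_content_row[of s "m # cs" s] cont by (simp flip: count_mset)
    finally have "count (mset r) s = m"
      by (simp add: count_mset)
    moreover have "mset r' = filter_mset (\<lambda>x. x \<noteq> s) (mset r)"
      by (simp add: r'_def)
    ultimately show ?thesis
      by (intro multiset_eqI) auto
  qed
  have "set r' \<subseteq> {Suc s..<Suc s + length cs}"
    using set by (force simp: r'_def rT)
  then obtain ks where ks: "length ks = length cs" "mset r' = mset (content_row (Suc s) ks)"
    by (rule mset_eq_content_row)
  have "set (concat T) \<subseteq> {Suc s..<Suc s + length cs}"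
    using set gt by (force simp: rT)
  then obtain ls where ls: "length ls = length cs" "mset (concat T) = mset (content_row (Suc s) ls)"
    by (rule mset_eq_content_row)
  have "mset (content_row (Suc s) (map2 (+) ks ls)) = mset (content_row (Suc s) cs)"
    using cont ks ls by (simp add: rT r_eq mset_content_row_add)
  then have "(ks, ls) \<in> splits cs"
    using ks ls by (auto simp: splits_def dest!: mset_content_row_inject)
  moreover have "r = replicate m s @ content_row (Suc s) ks"
  proof -
    have "mset r = mset (content_row s (m # ks))"
      by (simp add: r_eq ks)
    then have "r = content_row s (m # ks)"
      using r(2) sorted_content_row by (metis sorted_sort_id properties_for_sort)
    then show ?thesis by simp
  qed
  ultimately show "U \<in> ?f ` ?S"
    using T ls by (intro image_eqI[of _ _ "((ks, ls), T)"]) (auto simp: rT tableaux_def)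
qed

section \<open>Induction on the number of letters\<close>

lemma Q'_shape_Cons:
  assumes "immaculate_tableau (r # T)"
  shows "Q' (shape (r # T)) = opBt (int (length r)) (Q' (shape T))"
proof -
  have "immaculate_tableau T"
    using assms by (simp add: immaculate_tableau_def)
  then show ?thesis
    using assms by (simp add: Q'_def parts_shape)
qed

lemma finite_tableaux_row: "0 < s \<Longrightarrow> finite (tableaux s cs)"
\<comment> \<open>Induction is on the length because the content \<open>ls\<close> left over has the
  length of the tail but other entries.\<close>
proof (induction "length cs" arbitrary: cs s)
  case 0
  then show ?case by (simp add: tableaux_Nil)
next
  case (Suc n)
  then obtain m ds where cs: "cs = m # ds" "length ds = n"
    by (cases cs) auto
  show ?case
  proof (cases "m = 0")
    case True
    then show ?thesis using Suc cs by (simp add: tableaux_zero)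
  next
    case False
    then show ?thesis
      unfolding cs(1) using Suc cs
      by (subst tableaux_Cons) (auto intro!: finite_imageI finite_SigmaI finite_splits simp: splits_length)
  qed
qed

text \<open>Both sides obey the same recursion: \<open>ncH_mult_hprod\<close> expands the first
  factor over splits \<open>(ks, ls)\<close>, and \<open>tableaux_Cons\<close> attaches to each
  split the first row given by \<open>ks\<close> and the tableaux with content \<open>ls\<close>. A
  zero entry only shifts the alphabet.\<close>

lemma hprod_tableaux:
  "0 < s \<Longrightarrow> hprod cs = (\<Sum>T\<in>tableaux s cs. scale ((1 - q) ^ tab_stat T) (Q' (shape T)))"
proof (induction "length cs" arbitrary: cs s)
  case 0
  then show ?case
    by (simp add: tableaux_Nil hprod_def tab_stat_def Q'_def shape_def flip: zero_composition_def)
next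
  case (Suc n)
  then obtain m ds where cs: "cs = m # ds" "length ds = n"
    by (cases cs) auto
  show ?case
  proof (cases "m = 0")
    case True
    then show ?thesis
      using Suc.hyps(1)[of ds "Suc s"] cs by (simp add: tableaux_zero ncH_def)
  next
    case False
    let ?f = "\<lambda>((ks, ls), T). (replicate m s @ content_row (Suc s) ks) # T"
    let ?S = "SIGMA (ks, ls):splits ds. tableaux (Suc s) ls"
    let ?w = "\<lambda>T. scale ((1 - q) ^ tab_stat T) (Q' (shape T))"
    have tab: "tableaux s cs = ?f ` ?S"
      unfolding cs(1) using Suc.prems False by (intro tableaux_Cons) auto
    \<comment> \<open>The first row determines \<open>ks\<close>, and the content of the remaining
      rows determines \<open>ls\<close>.\<close>
    have inj: "inj_on ?f ?S"
    proof (rule inj_onI)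
      fix x y assume "x \<in> ?S" "y \<in> ?S" and eq: "?f x = ?f y"
      then obtain ks ls T ks' ls' T' where x: "x = ((ks, ls), T)" and y: "y = ((ks', ls'), T')"
        and kl: "(ks, ls) \<in> splits ds" "(ks', ls') \<in> splits ds"
        and T: "T \<in> tableaux (Suc s) ls" "T' \<in> tableaux (Suc s) ls'"
        by auto
      have "ks = ks'"
        using eq kl by (intro mset_content_row_inject[of "Suc s"]) (auto simp: x y splits_length)
      moreover have "ls = ls'"
        using eq kl T by (intro mset_content_row_inject[of "Suc s"])
          (auto simp: x y splits_length tableaux_def)
      ultimately show "x = y"
        using eq by (simp add: x y)
    qed
    have w: "?w (?f ((ks, ls), T)) = scale ((1 - q) ^ length (filter ((<) 0) ks))
        (opBt (int (m + sum_list ks)) (?w T))"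
      if "(ks, ls) \<in> splits ds" "T \<in> tableaux (Suc s) ls" for ks ls T
    proof -
      have "?f ((ks, ls), T) \<in> tableaux s cs"
        unfolding tab using that by (intro imageI) auto
      then have "Q' (shape (?f ((ks, ls), T))) = opBt (int (m + sum_list ks)) (Q' (shape T))"
        by (simp add: tableaux_def Q'_shape_Cons length_content_row)
      \<comment> \<open>The row has the letter \<open>s\<close> and one letter for each positive
        entry of \<open>ks\<close>; the \<open>- 1\<close> in \<open>tab_stat\<close> discounts
        \<open>s\<close>.\<close>
      moreover have "s \<notin> set (content_row (Suc s) ks)"
        using set_content_row[of "Suc s" ks] by auto
      then have "tab_stat (?f ((ks, ls), T)) = length (filter ((<) 0) ks) + tab_stat T"
        using False by (simp add: tab_stat_def card_content_row)
      ultimately show ?thesis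
        by (simp add: opBt_scale power_add)
    qed
    have pow: "prod_list (map (\<lambda>k. if k = 0 then 1 else 1 - q) ks) =
        (1 - q) ^ length (filter ((<) 0) ks)" for ks :: "nat list"
      by (induction ks) auto
    have "hprod cs = (\<Sum>(ks, ls)\<in>splits ds. scale ((1 - q) ^ length (filter ((<) 0) ks))
        (opBt (int (m + sum_list ks)) (hprod ls)))"
      unfolding cs(1) hprod_Cons ncH_mult_hprod expand_def by (simp only: fps_nth_ratio pow)
    also have "\<dots> = (\<Sum>(ks, ls)\<in>splits ds. \<Sum>T\<in>tableaux (Suc s) ls. ?w (?f ((ks, ls), T)))"
    proof (rule sum.cong[OF refl])
      fix x assume "x \<in> splits ds"
      then obtain ks ls where x: "x = (ks, ls)" and kl: "(ks, ls) \<in> splits ds"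
        by (cases x) auto
      have "hprod ls = (\<Sum>T\<in>tableaux (Suc s) ls. ?w T)"
        using cs splits_length[OF kl] by (intro Suc.hyps(1)) auto
      then show "(case x of (ks, ls) \<Rightarrow> scale ((1 - q) ^ length (filter ((<) 0) ks))
          (opBt (int (m + sum_list ks)) (hprod ls))) =
          (case x of (ks, ls) \<Rightarrow> \<Sum>T\<in>tableaux (Suc s) ls. ?w (?f ((ks, ls), T)))"
        using w[OF kl] by (simp add: x opBt_sum scale.scale_sum_right)
    qed
    also have "\<dots> = (\<Sum>x\<in>?S. ?w (?f x))"
      by (simp add: sum.Sigma finite_splits finite_tableaux_row case_prod_unfold)
    also have "\<dots> = (\<Sum>T\<in>tableaux s cs. ?w T)"
      unfolding tab by (simp add: sum.reindex[OF inj])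
    finally show ?thesis .
  qed
qed

theorem theorem4p10:
  fixes \<beta> :: composition
  shows "ncH_comp \<beta> =
    (\<Sum>T \<in> {T. immaculate_tableau T \<and> has_content T \<beta>}.
       scale ((1 - q) ^ tab_stat T) (Q' (shape T)))"
  using hprod_tableaux[of 1 "parts \<beta>"]
  by (simp add: hprod_def ncH_comp_def tableaux_def has_content_iff)

end
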